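(* For every integer $m\ge 1$, let $\Gamma_m$ be the ring of $m$ copies of $K_4$ minus an edge described in the context. Then the number of spanning trees of $\Gamma_m$ is $$c(\Gamma_m)=2m\,8^m.$$
   Context: The complexity $c(\Gamma)$ of a graph (multiple edges allowed) is the number of its spanning trees. The graph $\Gamma_m$ has $4m$ vertices, all of degree 3, and is formed as follows. Take $m$ pairwise disjoint graphs $G_1,\dots,G_m$, each isomorphic to the complete graph $K_4$ with one edge removed: $G_i$ has vertices $t_i,b_i,x_i,y_i$ and edges $t_ix_i,\ t_iy_i,\ x_iy_i,\ b_ix_i,\ b_iy_i$ (so $t_i$ and $b_i$ are its two vertices of degree 2). Then add $m$ edges $l_1,\dots,l_m$ linking them as a ring: $l_i$ joins $b_i$ to $t_{i+1}$, with indices modulo $m$. *)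

theory Defs
  imports Main
begin

text \<open>
  Undirected multigraphs. Edges are objects of their own, so several edges may have the same
  set of end points; a loop is an edge whose set of end points is a singleton.
\<close>

record ('v, 'e) multigraph =
  verts :: "'v set"
  edges :: "'e set"
  ends :: "'e \<Rightarrow> 'v set"

locale fin_multigraph =
  fixes G :: "('v, 'e) multigraph"
  assumes finite_verts: "finite (verts G)"
    and finite_edges: "finite (edges G)"
    and ends_in_verts: "e \<in> edges G \<Longrightarrow> ends G e \<subseteq> verts G"
    and card_ends: "e \<in> edges G \<Longrightarrow> card (ends G e) = 1 \<or> card (ends G e) = 2"

definition adj :: "('v, 'e) multigraph \<Rightarrow> 'v \<Rightarrow> 'v \<Rightarrow> bool" where
  "adj G u v \<longleftrightarrow> (\<exists>e\<in>edges G. ends G e = {u, v})"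

definition connected :: "('v, 'e) multigraph \<Rightarrow> bool" where
  "connected G \<longleftrightarrow> verts G \<noteq> {} \<and> (\<forall>u\<in>verts G. \<forall>v\<in>verts G. (adj G)\<^sup>*\<^sup>* u v)"

text \<open>
  A cycle is given by its vertices \<open>vs\<close> and edges \<open>es\<close> in cyclic order. Length 1 is a loop and
  length 2 a pair of parallel edges; distinctness of \<open>es\<close> prevents a single edge, traversed
  back and forth, from counting as a cycle.
\<close>

definition cycle :: "('v, 'e) multigraph \<Rightarrow> 'v list \<Rightarrow> 'e list \<Rightarrow> bool" where
  "cycle G vs es \<longleftrightarrow>
     es \<noteq> [] \<and> length vs = length es \<and> distinct vs \<and> distinct es \<and>
     set vs \<subseteq> verts G \<and> set es \<subseteq> edges G \<and>
     (\<forall>i<length es. ends G (es ! i) = {vs ! i, vs ! (Suc i mod length es)})"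

definition tree :: "('v, 'e) multigraph \<Rightarrow> bool" where
  "tree G \<longleftrightarrow> connected G \<and> (\<nexists>vs es. cycle G vs es)"

text \<open>
  A spanning subgraph has all vertices of \<open>G\<close>, so it is identified with its set of edges.
\<close>

definition spanning_tree :: "('v, 'e) multigraph \<Rightarrow> 'e set \<Rightarrow> bool" where
  "spanning_tree G F \<longleftrightarrow> F \<subseteq> edges G \<and> tree (G\<lparr>edges := F\<rparr>)"

definition complexity :: "('v, 'e) multigraph \<Rightarrow> nat" where
  "complexity G = card {F. spanning_tree G F}"

text \<open>
  The ring of \<open>m\<close> copies of \<open>K\<^sub>4\<close> minus an edge. The copies are numbered \<open>0, \<dots>, m - 1\<close>. In copy
  \<open>i\<close> the missing edge is the one between \<open>Tv i\<close> and \<open>Bv i\<close>; \<open>Link i\<close> leads to the next copy.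
\<close>

datatype ring_vert = Tv nat | Bv nat | Xv nat | Yv nat

datatype ring_edge = TX nat | TY nat | XY nat | BX nat | BY nat | Link nat

fun ring_ends :: "nat \<Rightarrow> ring_edge \<Rightarrow> ring_vert set" where
  "ring_ends m (TX i) = {Tv i, Xv i}"
| "ring_ends m (TY i) = {Tv i, Yv i}"
| "ring_ends m (XY i) = {Xv i, Yv i}"
| "ring_ends m (BX i) = {Bv i, Xv i}"
| "ring_ends m (BY i) = {Bv i, Yv i}"
| "ring_ends m (Link i) = {Bv i, Tv (Suc i mod m)}"

definition Gamma :: "nat \<Rightarrow> (ring_vert, ring_edge) multigraph" where
  "Gamma m =
     \<lparr>verts = (\<Union>i<m. {Tv i, Bv i, Xv i, Yv i}),
      edges = (\<Union>i<m. {TX i, TY i, XY i, BX i, BY i, Link i}),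
      ends = ring_ends m\<rparr>"

lemma fin_multigraph_Gamma: "fin_multigraph (Gamma m)"
  by unfold_locales (auto simp: Gamma_def)

end

(*
  A finite connected multigraph is a tree iff it has one more vertex than edges, because adding
  an edge either merges two components or closes a cycle. In a spanning tree of the ring, each
  copy together with its link contains at most 4 edges, and there are 4m - 1 edges in total, so
  exactly one copy has 3 and all others have 4. Four edges are the link and one of the 8 spanning
  trees of the copy; three edges are either a spanning tree of the copy without the link (8) or
  the link and a spanning forest of two trees separating t from b (8). Conversely all such edge
  sets are connected, so there are m * 16 * 8^(m-1) of them.
*)

theory Submission
  imports Defs "HOL-Library.FuncSet"
begin

section \<open>Trees and the number of edges\<close>

definition component :: "('v, 'e) multigraph \<Rightarrow> 'v \<Rightarrow> 'v set" where
  "component G v = {w \<in> verts G. (adj G)\<^sup>*\<^sup>* v w}"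

definition components :: "('v, 'e) multigraph \<Rightarrow> 'v set set" where
  "components G = component G ` verts G"

section \<open>Reachability, simple paths and crossing edges\<close>

lemma adj_sym: "adj G u v \<Longrightarrow> adj G v u"
  by (auto simp: adj_def insert_commute)

lemma reach_sym: "(adj G)\<^sup>*\<^sup>* u v \<Longrightarrow> (adj G)\<^sup>*\<^sup>* v u"
  by (induction rule: rtranclp_induct) (auto intro: adj_sym converse_rtranclp_into_rtranclp)

lemma reach_step: "e \<in> edges G \<Longrightarrow> ends G e = {u, v} \<Longrightarrow> (adj G)\<^sup>*\<^sup>* u v"
  by (rule r_into_rtranclp) (auto simp: adj_def)

text \<open>Loop erasure: when the next vertex \<open>c\<close> already lies on the path, the path
  is cut back to that occurrence; otherwise \<open>c\<close> is appended.\<close>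

lemma reach_distinct_path:
  assumes "(adj G)\<^sup>*\<^sup>* a b"
  shows "\<exists>n p. p 0 = a \<and> p n = b \<and> inj_on p {..n} \<and> (\<forall>i<n. adj G (p i) (p (Suc i)))"
  using assms
proof induction
  case base
  show ?case by (rule exI[of _ 0], rule exI[of _ "\<lambda>_. a"]) auto
next
  case (step b c)
  then obtain n p where p: "p 0 = a" "p n = b" "inj_on p {..n}"
    "\<And>i. i < n \<Longrightarrow> adj G (p i) (p (Suc i))"
    by blast
  show ?case
  proof (cases "c \<in> p ` {..n}")
    case True
    then obtain k where k: "k \<le> n" "p k = c" by auto
    have "inj_on p {..k}"
      by (rule inj_on_subset[OF p(3)]) (use k in auto)
    then show ?thesis
      using p k by (intro exI[of _ k] exI[of _ p]) auto
  next
    case False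
    let ?q = "p(Suc n := c)"
    have "inj_on ?q {..Suc n}"
      using p(3) False by (auto simp: inj_on_def atMost_Suc image_iff)
    moreover have "adj G (?q i) (?q (Suc i))" if "i < Suc n" for i
      using that p step.hyps(2) by (cases "i = n") auto
    ultimately show ?thesis
      using p(1) by (intro exI[of _ "Suc n"] exI[of _ ?q]) (simp del: fun_upd_apply, simp)
  qed
qed

text \<open>A walk from \<open>u\<close> to \<open>v\<close> starts in \<open>W\<close> and ends
  outside it, so one of its steps leaves \<open>W\<close>.\<close>

lemma connected_crossing_edge:
  assumes "connected G" "u \<in> verts G" "u \<in> W" "v \<in> verts G" "v \<notin> W"
  obtains e x y where "e \<in> edges G" "ends G e = {x, y}" "x \<in> W" "y \<notin> W"
proof -
  have "(adj G)\<^sup>*\<^sup>* u v"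
    using assms by (auto simp: connected_def)
  then have "\<exists>x y. adj G x y \<and> x \<in> W \<and> y \<notin> W"
    using assms(3,5) by induction blast+
  then show thesis
    using that by (auto simp: adj_def)
qed

lemma cycle_mono:
  assumes "cycle (G\<lparr>edges := F\<rparr>) vs es" "F \<subseteq> F'"
  shows "cycle (G\<lparr>edges := F'\<rparr>) vs es"
  using assms by (auto simp: cycle_def)

section \<open>Adding one edge: reachability and the number of components\<close>

context fin_multigraph
begin

abbreviation reach :: "'e set \<Rightarrow> 'v \<Rightarrow> 'v \<Rightarrow> bool" where
  "reach F \<equiv> (adj (G\<lparr>edges := F\<rparr>))\<^sup>*\<^sup>*"

lemma edge_ends:
  assumes "e \<in> edges G"
  obtains a b where "ends G e = {a, b}" "a \<in> verts G" "b \<in> verts G"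
proof -
  have "\<exists>a b. ends G e = {a, b}"
    using card_ends[OF assms] by (metis card_1_singletonE card_2_iff insert_absorb2)
  then show thesis
    using that ends_in_verts[OF assms] by auto
qed

text \<open>A walk never has to cross \<open>e\<close> twice: crossing it back returns to the end
  point that was already reached without it.\<close>

lemma reach_insert:
  assumes e: "ends G e = {a, b}"
  shows "reach (insert e F) x y \<longleftrightarrow>
    reach F x y \<or> (reach F x a \<and> reach F b y) \<or> (reach F x b \<and> reach F a y)"
    (is "?l = ?r")
proof
  assume ?l
  then show ?r
  proof induction
    case (step y z)
    have "adj (G\<lparr>edges := F\<rparr>) y z \<or> y = a \<and> z = b \<or> y = b \<and> z = a"
      using step.hyps(2) e by (auto simp: adj_def doubleton_eq_iff)
    then show ?case
      using step.IH by (blast intro: rtranclp.rtrancl_into_rtrancl)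
  qed simp
next
  have mono: "reach (insert e F) u v" if "reach F u v" for u v
    using rtranclp_mono[of "adj (G\<lparr>edges := F\<rparr>)" "adj (G\<lparr>edges := insert e F\<rparr>)"] that
    by (auto simp: adj_def le_fun_def)
  have ab: "reach (insert e F) a b"
    by (rule reach_step[of e]) (simp_all add: e)
  have ba: "reach (insert e F) b a"
    using ab by (rule reach_sym)
  assume ?r
  then consider "reach F x y" | "reach F x a" "reach F b y" | "reach F x b" "reach F a y"
    by blast
  then show ?l
  proof cases
    case 1
    then show ?thesis by (rule mono)
  next
    case 2
    then show ?thesis by (intro rtranclp_trans[OF mono rtranclp_trans[OF ab mono]])
  next
    case 3
    then show ?thesis by (intro rtranclp_trans[OF mono rtranclp_trans[OF ba mono]])
  qed
qed

lemma finite_components: "finite (components (G\<lparr>edges := F\<rparr>))"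
  by (simp add: components_def finite_verts)

lemma component_eqI:
  assumes "reach F u v"
  shows "component (G\<lparr>edges := F\<rparr>) u = component (G\<lparr>edges := F\<rparr>) v"
  using assms reach_sym[OF assms] by (auto simp: component_def intro: rtranclp_trans)

lemma component_eq_iff:
  assumes "v \<in> verts G"
  shows "component (G\<lparr>edges := F\<rparr>) u = component (G\<lparr>edges := F\<rparr>) v \<longleftrightarrow> reach F u v"
  using component_eqI assms by (auto simp: component_def)

text \<open>By \<open>reach_insert\<close>, a component changes only if it contains an end point of
  \<open>e\<close>, and then it absorbs the component of the other one. The formula also covers
  \<open>C a = C b\<close>, where the set removed is the set put back.\<close>

lemma components_insert:
  fixes F
  assumes e: "ends G e = {a, b}" "a \<in> verts G" "b \<in> verts G"
  defines "C \<equiv> component (G\<lparr>edges := F\<rparr>)"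
  shows "components (G\<lparr>edges := insert e F\<rparr>) =
    insert (C a \<union> C b) (components (G\<lparr>edges := F\<rparr>) - {C a, C b})"
proof -
  let ?C' = "component (G\<lparr>edges := insert e F\<rparr>)"
  have C': "?C' x = (if C x = C a \<or> C x = C b then C a \<union> C b else C x)" for x
  proof -
    have "?C' x = C x \<union> (if reach F x a then C b else {}) \<union> (if reach F x b then C a else {})"
      by (auto simp: component_def C_def reach_insert[OF e(1)])
    moreover have "reach F x a \<longleftrightarrow> C x = C a" "reach F x b \<longleftrightarrow> C x = C b"
      using e by (simp_all add: C_def component_eq_iff)
    ultimately show ?thesis by auto
  qed
  have 1: "components (G\<lparr>edges := insert e F\<rparr>) = ?C' ` verts G"
    "components (G\<lparr>edges := F\<rparr>) = C ` verts G"
    by (simp_all add: components_def C_def)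
  show ?thesis
    unfolding 1 using e by (auto simp: C' image_iff)
qed

text \<open>Two components merge exactly if \<open>F\<close> does not yet join the end points. A
  loop, or an \<open>e\<close> already in \<open>F\<close>, falls under the summand 0.\<close>

lemma card_components_insert:
  assumes e: "ends G e = {a, b}" "a \<in> verts G" "b \<in> verts G"
  shows "card (components (G\<lparr>edges := F\<rparr>)) =
    card (components (G\<lparr>edges := insert e F\<rparr>)) + (if reach F a b then 0 else 1)"
proof -
  let ?C = "component (G\<lparr>edges := F\<rparr>)" and ?K = "components (G\<lparr>edges := F\<rparr>)"
  have in_K: "?C a \<in> ?K" "?C b \<in> ?K"
    using e by (auto simp: components_def)
  show ?thesis
  proof (cases "reach F a b")
    case True
    then have "?C a = ?C b" by (rule component_eqI)
    then show ?thesis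
      using True in_K by (simp add: components_insert[OF e] insert_absorb)
  next
    case False
    then have ne: "?C a \<noteq> ?C b"
      using e by (simp add: component_eq_iff)
    \<comment> \<open>The merged set must differ from all remaining components, so that inserting it
      raises the cardinality: a component containing \<open>a\<close> can only be
      \<open>?C a\<close>.\<close>
    have "?C a \<union> ?C b \<notin> ?K - {?C a, ?C b}"
    proof
      assume "?C a \<union> ?C b \<in> ?K - {?C a, ?C b}"
      then obtain x where x: "x \<in> verts G" "?C a \<union> ?C b = ?C x" "?C x \<noteq> ?C a"
        by (auto simp: components_def)
      have "a \<in> ?C x"
        using x(2) e by (auto simp: component_def)
      then have "reach F x a" by (simp add: component_def)
      then show False
        using x(3) component_eqI by blast
    qed
    then have "card (components (G\<lparr>edges := insert e F\<rparr>)) = Suc (card (?K - {?C a, ?C b}))"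
      by (simp add: components_insert[OF e] finite_components)
    \<comment> \<open>Keeps the subtraction of natural numbers below from truncating.\<close>
    moreover have "card {?C a, ?C b} \<le> card ?K"
      using in_K by (intro card_mono finite_components) auto
    moreover have "card (?K - {?C a, ?C b}) = card ?K - card {?C a, ?C b}"
      using in_K by (intro card_Diff_subset) auto
    ultimately show ?thesis
      using False ne by simp
  qed
qed

section \<open>Edge counts of forests and trees\<close>

lemma card_components_no_edges: "card (components (G\<lparr>edges := {}\<rparr>)) = card (verts G)"
proof -
  have "reach {} x y \<Longrightarrow> x = y" for x y
    by (induction rule: rtranclp_induct) (auto simp: adj_def)
  then have "components (G\<lparr>edges := {}\<rparr>) = (\<lambda>x. {x}) ` verts G"
    by (auto simp: components_def component_def intro!: image_cong)
  then show ?thesis by (simp add: card_image)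
qed

text \<open>Without edges every vertex is its own component, and each inserted edge lowers the
  number of components by at most one.\<close>

lemma card_verts_le:
  assumes "F \<subseteq> edges G"
  shows "card (verts G) \<le> card (components (G\<lparr>edges := F\<rparr>)) + card F"
proof -
  have "finite F" using assms finite_edges finite_subset by blast
  then show ?thesis
    using assms
  proof induction
    case (insert e F)
    obtain a b where e: "ends G e = {a, b}" "a \<in> verts G" "b \<in> verts G"
      using insert.prems edge_ends by blast
    show ?case
      using insert card_components_insert[OF e, of F] by (auto split: if_splits)
  qed (simp add: card_components_no_edges)
qed

text \<open>A simple path from \<open>a\<close> to \<open>b\<close> in \<open>F\<close> is closed up
  by \<open>e\<close>. If \<open>a = b\<close>, the path has length 0 and the cycle is the loop
  \<open>e\<close>.\<close>

lemma reach_insert_cycle: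
  assumes "reach F a b" "ends G e = {a, b}" "e \<notin> F" "a \<in> verts G" "F \<subseteq> edges G"
  shows "\<exists>vs es. cycle (G\<lparr>edges := insert e F\<rparr>) vs es"
proof -
  obtain n p where p: "p 0 = a" "p n = b" "inj_on p {..n}"
    "\<And>i. i < n \<Longrightarrow> adj (G\<lparr>edges := F\<rparr>) (p i) (p (Suc i))"
    using reach_distinct_path[OF assms(1)] by blast
  have "\<exists>d. d \<in> F \<and> ends G d = {p i, p (Suc i)}" if "i < n" for i
    using p(4)[OF that] by (auto simp: adj_def)
  then obtain d where d: "\<And>i. i < n \<Longrightarrow> d i \<in> F \<and> ends G (d i) = {p i, p (Suc i)}"
    by metis
  \<comment> \<open>A repeated edge would have the same pair of end points at both positions. As
    \<open>p\<close> is injective, the swapped matching would need \<open>i = Suc j\<close> and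
    \<open>Suc i = j\<close>.\<close>
  have "i = j" if "i < n" "j < n" "d i = d j" for i j
  proof -
    have "{p i, p (Suc i)} = {p j, p (Suc j)}"
      using that d by metis
    then have "p i = p j \<or> p i = p (Suc j) \<and> p (Suc i) = p j"
      by (auto simp: doubleton_eq_iff)
    then show ?thesis
      using that inj_on_eq_iff[OF p(3)] by auto
  qed
  then have inj_d: "inj_on d {..<n}" by (auto simp: inj_on_def)
  let ?vs = "map p [0..<Suc n]" and ?es = "map d [0..<n] @ [e]"
  have "p i \<in> verts G" if "i \<le> n" for i
  proof (cases i)
    case (Suc k)
    then have "d k \<in> edges G" "p i \<in> ends G (d k)" using d[of k] that assms(5) by auto
    then show ?thesis using ends_in_verts by blast
  qed (use p assms in auto)
  then have "set ?vs \<subseteq> verts G" by auto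
  moreover have "distinct ?vs"
    using p(3) by (simp add: distinct_map inj_on_subset atLeast0LessThan lessThan_Suc_atMost del: upt_Suc)
  moreover have "distinct ?es"
    using inj_d d assms(3) by (auto simp: distinct_map atLeast0LessThan)
  moreover have "ends G (?es ! i) = {?vs ! i, ?vs ! (Suc i mod length ?es)}" if "i < length ?es" for i
  proof (cases "i = n")
    case True
    then show ?thesis
      using p assms(2) by (simp add: nth_append insert_commute del: upt_Suc)
  next
    case False
    then show ?thesis
      using that d by (simp add: nth_append del: upt_Suc)
  qed
  ultimately have "cycle (G\<lparr>edges := insert e F\<rparr>) ?vs ?es"
    using d by (auto simp: cycle_def simp del: upt_Suc)
  then show ?thesis by blast
qed

text \<open>The equality case of \<open>card_verts_le\<close>: without cycles, no inserted edge
  joins two vertices that were already connected, so each one lowers the number of components by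
  exactly one.\<close>

lemma card_verts_acyclic:
  assumes "F \<subseteq> edges G" "\<nexists>vs es. cycle (G\<lparr>edges := F\<rparr>) vs es"
  shows "card (verts G) = card (components (G\<lparr>edges := F\<rparr>)) + card F"
proof -
  have "finite F" using assms finite_edges finite_subset by blast
  then show ?thesis
    using assms
  proof induction
    case (insert e F)
    obtain a b where e: "ends G e = {a, b}" "a \<in> verts G" "b \<in> verts G"
      using insert.prems edge_ends by blast
    have "\<not> reach F a b"
      using reach_insert_cycle[OF _ e(1) insert.hyps(2) e(2)] insert.prems by auto
    moreover have "\<nexists>vs es. cycle (G\<lparr>edges := F\<rparr>) vs es"
    proof (intro notI, elim exE)
      fix vs es
      assume "cycle (G\<lparr>edges := F\<rparr>) vs es"
      then have "cycle (G\<lparr>edges := insert e F\<rparr>) vs es"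
        by (rule cycle_mono) auto
      then show False
        using insert.prems(2) by blast
    qed
    ultimately show ?case
      using insert card_components_insert[OF e, of F] by simp
  qed (simp add: card_components_no_edges)
qed

text \<open>The edge chosen is the closing one, \<open>es ! n\<close>; the other edges of the cycle
  lead from its first vertex to its last.\<close>

lemma cycle_edge_redundant:
  assumes "cycle G vs es"
  obtains e a b where "e \<in> edges G" "ends G e = {a, b}" "a \<in> verts G" "b \<in> verts G"
    "reach (edges G - {e}) a b"
proof -
  obtain n where n: "length es = Suc n"
    using assms by (cases es) (auto simp: cycle_def)
  then have c: "length es = Suc n" "length vs = Suc n" "distinct es" "set vs \<subseteq> verts G"
    "set es \<subseteq> edges G" "\<And>i. i \<le> n \<Longrightarrow> ends G (es ! i) = {vs ! i, vs ! (Suc i mod Suc n)}"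
    using assms by (auto simp: cycle_def less_Suc_eq_le)
  have "reach (edges G - {es ! n}) (vs ! 0) (vs ! i)" if "i \<le> n" for i
    using that
  proof (induction i)
    case (Suc i)
    then have "es ! i \<in> edges G" "es ! i \<noteq> es ! n"
      using c(1,3,5) by (auto simp: nth_eq_iff_index_eq)
    then have "reach (edges G - {es ! n}) (vs ! i) (vs ! Suc i)"
      using c(6)[of i] Suc.prems by (intro reach_step[of "es ! i"]) auto
    then show ?case
      using Suc by (meson Suc_leD rtranclp_trans)
  qed simp
  moreover have "vs ! 0 \<in> verts G" "vs ! n \<in> verts G" "es ! n \<in> edges G"
    using c by (auto simp: subset_iff)
  moreover have "ends G (es ! n) = {vs ! 0, vs ! n}"
    using c(6)[of n] by auto
  ultimately show thesis
    using that by blast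
qed

lemma connected_iff_card_components: "connected G \<longleftrightarrow> card (components G) = 1"
proof
  assume "connected G"
  then have "component G v = verts G" if "v \<in> verts G" for v
    using that by (auto simp: connected_def component_def)
  moreover have "verts G \<noteq> {}"
    using \<open>connected G\<close> by (simp add: connected_def)
  ultimately have "components G = {verts G}"
    by (auto simp: components_def)
  then show "card (components G) = 1" by simp
next
  assume "card (components G) = 1"
  then obtain K where K: "component G ` verts G = {K}"
    by (auto simp: components_def card_1_singleton_iff)
  then have "verts G \<noteq> {}" by auto
  moreover have "(adj G)\<^sup>*\<^sup>* u v" if "u \<in> verts G" "v \<in> verts G" for u v
  proof -
    have "component G u = K" "component G v = K" using K that by blast+
    then have "component G u = component G v" by simp
    then have "v \<in> component G u" using that by (simp add: component_def)
    then show ?thesis by (simp add: component_def)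
  qed
  ultimately show "connected G" by (simp add: connected_def)
qed

theorem tree_iff_connected_card: "tree G \<longleftrightarrow> connected G \<and> card (verts G) = Suc (card (edges G))"
proof (intro iffI conjI)
  assume t: "tree G"
  then show "connected G" by (simp add: tree_def)
  then show "card (verts G) = Suc (card (edges G))"
    using t card_verts_acyclic[of "edges G"]
    by (simp add: tree_def connected_iff_card_components)
next
  assume c: "connected G \<and> card (verts G) = Suc (card (edges G))"
  have False if cyc: "cycle G vs es" for vs es
  proof -
    obtain e a b where e: "e \<in> edges G" "ends G e = {a, b}" "a \<in> verts G" "b \<in> verts G"
      "reach (edges G - {e}) a b"
      using cycle_edge_redundant[OF cyc] .
    \<comment> \<open>Deleting an edge of the cycle keeps the graph connected, but leaves one edge
      fewer than \<open>card_verts_le\<close> demands of a connected graph.\<close>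
    have "card (components (G\<lparr>edges := edges G - {e}\<rparr>)) = 1"
      using card_components_insert[OF e(2-4), of "edges G - {e}"] e c
      by (simp add: insert_absorb connected_iff_card_components)
    then have "card (verts G) \<le> 1 + card (edges G - {e})"
      using card_verts_le[of "edges G - {e}"] by simp
    moreover have "card (edges G - {e}) < card (edges G)"
      using e(1) finite_edges by (rule card_Diff1_less[rotated])
    ultimately show False using c by simp
  qed
  then show "tree G" using c by (auto simp: tree_def)
qed

end

section \<open>Spanning trees of the ring\<close>

type_synonym pattern = "bool \<times> bool \<times> bool \<times> bool \<times> bool \<times> bool"

text \<open>Boolean tuples form an enumerable type, so the numbers of local choices can be computed
  by evaluation.\<close>

definition pattern :: "ring_edge set \<Rightarrow> nat \<Rightarrow> pattern" where
  "pattern F i = (TX i \<in> F, TY i \<in> F, XY i \<in> F, BX i \<in> F, BY i \<in> F, Link i \<in> F)"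

fun pattern_size :: "pattern \<Rightarrow> nat" where
  "pattern_size (tx, ty, xy, bx, by, l) =
     of_bool tx + of_bool ty + of_bool xy + of_bool bx + of_bool by + of_bool l"

text \<open>
  The first three conditions hold in a connected graph, because \<open>{X}\<close>, \<open>{Y}\<close> and \<open>{X, Y}\<close> are
  not cut off; the last three exclude the cycles inside a copy.
\<close>

fun admissible :: "pattern \<Rightarrow> bool" where
  "admissible (tx, ty, xy, bx, by, l) \<longleftrightarrow>
     (tx \<or> xy \<or> bx) \<and> (ty \<or> xy \<or> by) \<and> (tx \<or> ty \<or> bx \<or> by) \<and>
     \<not> (tx \<and> ty \<and> xy) \<and> \<not> (bx \<and> by \<and> xy) \<and> \<not> (tx \<and> ty \<and> bx \<and> by)"

definition patterns :: "nat \<Rightarrow> pattern set" where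
  "patterns n = {p. admissible p \<and> pattern_size p = n}"

lemma card_patterns: "card (patterns 3) = 16" "card (patterns 4) = 8"
proof -
  \<comment> \<open>As a filtered list of all 64 tuples, the set becomes executable.\<close>
  have *: "patterns n = set (filter (\<lambda>p. admissible p \<and> pattern_size p = n) Enum.enum)" for n
    by (auto simp: patterns_def enum_UNIV)
  show "card (patterns 3) = 16" "card (patterns 4) = 8"
    unfolding * by code_simp+
qed

text \<open>Any four of the five inner edges contain one of the two triangles or the
  4-cycle.\<close>

lemma admissible_size_le:
  assumes "admissible (pattern F i)"
  shows "pattern_size (pattern F i) \<le> 3 + of_bool (Link i \<in> F)"
  using assms
  by (cases "TX i \<in> F"; cases "TY i \<in> F"; cases "BX i \<in> F"; cases "BY i \<in> F")
    (auto simp: pattern_def)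

lemma card_eq_sum_pattern_size:
  assumes "F \<subseteq> edges (Gamma m)"
  shows "card F = (\<Sum>i<m. pattern_size (pattern F i))"
proof -
  let ?E = "\<lambda>i. {TX i, TY i, XY i, BX i, BY i, Link i}"
  have "F = (\<Union>i<m. ?E i \<inter> F)"
    using assms by (auto simp: Gamma_def)
  then have "card F = card (\<Union>i<m. ?E i \<inter> F)" by simp
  also have "\<dots> = (\<Sum>i<m. card (?E i \<inter> F))"
    by (rule card_UN_disjoint) auto
  also have "\<dots> = (\<Sum>i<m. pattern_size (pattern F i))"
    by (rule sum.cong) (simp_all add: pattern_def Int_insert_left)
  finally show ?thesis .
qed

lemma card_verts_Gamma: "card (verts (Gamma m)) = 4 * m"
proof -
  have "card (verts (Gamma m)) = card (\<Union>i<m. {Tv i, Bv i, Xv i, Yv i})"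
    by (simp add: Gamma_def)
  also have "\<dots> = (\<Sum>i<m. card {Tv i, Bv i, Xv i, Yv i})"
    by (rule card_UN_disjoint) auto
  finally show ?thesis by simp
qed

section \<open>Which families of patterns come from spanning trees\<close>

lemma fin_multigraph_subgraph:
  assumes "F \<subseteq> edges (Gamma m)"
  shows "fin_multigraph (Gamma m\<lparr>edges := F\<rparr>)"
proof -
  interpret fin_multigraph "Gamma m" by (rule fin_multigraph_Gamma)
  show ?thesis
    using assms finite_verts finite_edges ends_in_verts card_ends
    by unfold_locales (auto intro: finite_subset)
qed

lemma tree_imp_admissible:
  assumes F: "F \<subseteq> edges (Gamma m)" and tree: "tree (Gamma m\<lparr>edges := F\<rparr>)" and i: "i < m"
  shows "admissible (pattern F i)"
proof -
  let ?S = "Gamma m\<lparr>edges := F\<rparr>"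
  have conn: "connected ?S" and no_cycle: "\<And>vs es. \<not> cycle ?S vs es"
    using tree by (auto simp: tree_def)
  \<comment> \<open>\<open>Tv i\<close> lies outside all three sets. Links never meet an
    \<open>Xv\<close> or \<open>Yv\<close>, so the crossing edge is always an inner edge of copy
    \<open>i\<close>.\<close>
  have cut: "\<exists>e x y. e \<in> F \<and> ring_ends m e = {x, y} \<and> x \<in> W \<and> y \<notin> W"
    if W: "W = {Xv i} \<or> W = {Yv i} \<or> W = {Xv i, Yv i}" for W
  proof -
    obtain u where u: "u \<in> verts ?S" "u \<in> W"
      using W i by (auto simp: Gamma_def)
    have "Tv i \<in> verts ?S" "Tv i \<notin> W"
      using W i by (auto simp: Gamma_def)
    then show ?thesis
      by (rule connected_crossing_edge[OF conn u]) (auto simp: Gamma_def)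
  qed
  have "TX i \<in> F \<or> XY i \<in> F \<or> BX i \<in> F"
  proof -
    obtain e x y where "e \<in> F" "ring_ends m e = {x, y}" "x \<in> {Xv i}" "y \<notin> {Xv i}"
      using cut[of "{Xv i}"] by blast
    then show ?thesis by (cases e) (auto simp: doubleton_eq_iff)
  qed
  moreover have "TY i \<in> F \<or> XY i \<in> F \<or> BY i \<in> F"
  proof -
    obtain e x y where "e \<in> F" "ring_ends m e = {x, y}" "x \<in> {Yv i}" "y \<notin> {Yv i}"
      using cut[of "{Yv i}"] by blast
    then show ?thesis by (cases e) (auto simp: doubleton_eq_iff)
  qed
  moreover have "TX i \<in> F \<or> TY i \<in> F \<or> BX i \<in> F \<or> BY i \<in> F"
  proof -
    obtain e x y where "e \<in> F" "ring_ends m e = {x, y}" "x \<in> {Xv i, Yv i}" "y \<notin> {Xv i, Yv i}"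
      using cut[of "{Xv i, Yv i}"] by blast
    then show ?thesis by (cases e) (auto simp: doubleton_eq_iff)
  qed
  \<comment> \<open>For this and the next two cycles the lists are aligned: each edge joins the
    vertex at its position to the next one, and the last edge closes up.\<close>
  moreover have "\<not> (TX i \<in> F \<and> TY i \<in> F \<and> XY i \<in> F)"
    using no_cycle[of "[Tv i, Xv i, Yv i]" "[TX i, XY i, TY i]"] i
    by (auto simp: cycle_def Gamma_def less_Suc_eq insert_commute)
  moreover have "\<not> (BX i \<in> F \<and> BY i \<in> F \<and> XY i \<in> F)"
    using no_cycle[of "[Bv i, Xv i, Yv i]" "[BX i, XY i, BY i]"] i
    by (auto simp: cycle_def Gamma_def less_Suc_eq insert_commute)
  moreover have "\<not> (TX i \<in> F \<and> TY i \<in> F \<and> BX i \<in> F \<and> BY i \<in> F)"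
    using no_cycle[of "[Tv i, Xv i, Bv i, Yv i]" "[TX i, BX i, BY i, TY i]"] i
    by (auto simp: cycle_def Gamma_def less_Suc_eq insert_commute)
  ultimately show ?thesis
    by (simp add: pattern_def)
qed

text \<open>Abstracting reachability to an equivalence relation leaves a finite case check. Three
  acyclic inner edges form a spanning tree of the copy. With two, the cut conditions still attach
  \<open>x\<close> and \<open>y\<close> each to \<open>t\<close> or \<open>b\<close>.\<close>

lemma admissible_connected:
  fixes R :: "'a \<Rightarrow> 'a \<Rightarrow> bool"
  assumes R: "equivp R"
    and edges: "tx \<Longrightarrow> R t x" "ty \<Longrightarrow> R t y" "xy \<Longrightarrow> R x y" "bx \<Longrightarrow> R b x" "by \<Longrightarrow> R b y"
    and adm: "admissible (tx, ty, xy, bx, by, l)"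
  shows "pattern_size (tx, ty, xy, bx, by, l) = 3 + of_bool l \<Longrightarrow> R t b \<and> R t x \<and> R t y"
    and "pattern_size (tx, ty, xy, bx, by, l) = 2 + of_bool l \<Longrightarrow>
      (R t x \<or> R b x) \<and> (R t y \<or> R b y)"
proof -
  have sym: "R u v \<Longrightarrow> R v u" and trans: "R u v \<Longrightarrow> R v w \<Longrightarrow> R u w" for u v w
    using R by (blast elim: equivpE dest: sympD transpD)+
  show "R t b \<and> R t x \<and> R t y" if "pattern_size (tx, ty, xy, bx, by, l) = 3 + of_bool l"
    using that adm edges
    by (cases tx; cases ty; cases xy; cases bx; cases "by"; simp) (meson sym trans)+
  show "(R t x \<or> R b x) \<and> (R t y \<or> R b y)"
    if "pattern_size (tx, ty, xy, bx, by, l) = 2 + of_bool l"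
    using that adm edges
    by (cases tx; cases ty; cases xy; cases bx; cases "by"; simp) (meson sym trans)+
qed

lemma equivp_reach: "equivp (adj G)\<^sup>*\<^sup>*"
  by (intro equivpI reflpI sympI transpI) (auto intro: reach_sym)

text \<open>From the top of the copy after \<open>j\<close> one walks around the ring through intact
  copies and reaches copy \<open>j\<close> last. If copy \<open>j\<close> itself is split, its
  bottom is reached through \<open>Link j\<close> from the other side.\<close>

lemma connected_if_patterns:
  assumes F: "F \<subseteq> edges (Gamma m)" and j: "j < m"
    and pat: "\<And>i. i < m \<Longrightarrow> pattern F i \<in> patterns (if i = j then 3 else 4)"
  shows "connected (Gamma m\<lparr>edges := F\<rparr>)"
proof -
  let ?R = "(adj (Gamma m\<lparr>edges := F\<rparr>))\<^sup>*\<^sup>*"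
  have step: "?R u v" if "e \<in> F" "ring_ends m e = {u, v}" for e u v
    using that by (intro reach_step[of e]) (auto simp: Gamma_def)
  note sym = reach_sym[of "Gamma m\<lparr>edges := F\<rparr>"]
  note trans = rtranclp_trans[of "adj (Gamma m\<lparr>edges := F\<rparr>)"]
  have link: "?R (Bv i) (Tv (Suc i mod m))" if "Link i \<in> F" for i
    using that by (rule step) simp
  have adm: "admissible (pattern F i)" and size: "pattern_size (pattern F i) = (if i = j then 3 else 4)"
    if "i < m" for i
    using pat[OF that] by (auto simp: patterns_def split: if_splits)
  have whole: "?R (Tv i) (Bv i) \<and> ?R (Tv i) (Xv i) \<and> ?R (Tv i) (Yv i)"
    if "i < m" "pattern_size (pattern F i) = 3 + of_bool (Link i \<in> F)" for i
    by (rule admissible_connected(1)[OF equivp_reach _ _ _ _ _ adm[OF that(1), unfolded pattern_def]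
          that(2)[unfolded pattern_def]])
      (auto intro: step)
  have split: "(?R (Tv i) (Xv i) \<or> ?R (Bv i) (Xv i)) \<and> (?R (Tv i) (Yv i) \<or> ?R (Bv i) (Yv i))"
    if "i < m" "pattern_size (pattern F i) = 2 + of_bool (Link i \<in> F)" for i
    by (rule admissible_connected(2)[OF equivp_reach _ _ _ _ _ adm[OF that(1), unfolded pattern_def]
          that(2)[unfolded pattern_def]])
      (auto intro: step)
  \<comment> \<open>Such a copy has four edges, at most three of them inner, so the link is
    present.\<close>
  have linked: "Link i \<in> F" if "i < m" "i \<noteq> j" for i
    using admissible_size_le[OF adm[OF that(1)]] size[OF that(1)] that(2)
    by (auto simp: of_bool_def split: if_splits)
  let ?r = "Tv (Suc j mod m)"
  have around: "?R ?r (Tv ((Suc j + k) mod m))" if "k < m" for k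
    using that
  proof (induction k)
    case (Suc k)
    let ?i = "(Suc j + k) mod m"
    have "?i < m" using j by simp
    \<comment> \<open>A return to \<open>j\<close> would need \<open>m\<close> to divide
      \<open>Suc k\<close>, which is positive and below \<open>m\<close>. Hence the walk never has
      to pass through copy \<open>j\<close>.\<close>
    moreover have "?i \<noteq> j"
    proof
      assume "?i = j"
      then have "(j + Suc k) mod m = j mod m" using j by simp
      then have "m dvd Suc k" by (metis add_diff_cancel_left' le_add1 mod_eq_dvd_iff_nat)
      then show False using Suc.prems by (auto dest: dvd_imp_le)
    qed
    ultimately have "?R (Tv ?i) (Bv ?i)" "?R (Bv ?i) (Tv (Suc ?i mod m))"
      using linked[of ?i] whole[of ?i] size[of ?i] link[of ?i] by auto
    then show ?case
      using Suc by (simp add: mod_Suc_eq)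
  qed simp
  have top: "?R ?r (Tv i)" if "i < m" for i
  proof -
    \<comment> \<open>The witness is the number of links from copy \<open>j + 1\<close> forward to
      copy \<open>i\<close>; for \<open>i = j\<close> it is \<open>m - 1\<close>.\<close>
    have "\<exists>k<m. i = (Suc j + k) mod m"
    proof (cases "j < i")
      case True
      then show ?thesis using that by (intro exI[of _ "i - Suc j"]) auto
    next
      case False
      then show ?thesis using that j by (intro exI[of _ "i + m - Suc j"]) auto
    qed
    then show ?thesis using around by blast
  qed
  \<comment> \<open>Only copy \<open>j\<close> with its link present has just two inner edges; every
    other copy is connected in itself.\<close>
  have all: "?R ?r (Tv i) \<and> ?R ?r (Bv i) \<and> ?R ?r (Xv i) \<and> ?R ?r (Yv i)" if "i < m" for i
  proof (cases "i = j \<and> Link i \<in> F")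
    case True
    then have "?R ?r (Bv i)" using link[of i] sym by blast
    moreover have "pattern_size (pattern F i) = 2 + of_bool (Link i \<in> F)"
      using True size[OF that] by auto
    ultimately show ?thesis
      using split[OF that] top[OF that] trans[of ?r "Tv i"] trans[of ?r "Bv i"] by blast
  next
    case False
    then have "pattern_size (pattern F i) = 3 + of_bool (Link i \<in> F)"
      using size[OF that] linked[OF that] by auto
    then show ?thesis
      using whole[OF that] top[OF that] trans[of ?r "Tv i"] by blast
  qed
  have "?R ?r v" if "v \<in> verts (Gamma m)" for v
    using that all by (auto simp: Gamma_def)
  then have "?R u v" if "u \<in> verts (Gamma m)" "v \<in> verts (Gamma m)" for u v
    using that sym trans[of u ?r v] by blast
  then show ?thesis
    using j by (auto simp: connected_def Gamma_def)
qed

lemma spanning_tree_Gamma_iff: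
  "spanning_tree (Gamma m) F \<longleftrightarrow>
    F \<subseteq> edges (Gamma m) \<and>
    (\<exists>j<m. \<forall>i<m. pattern F i \<in> patterns (if i = j then 3 else 4))"
proof (cases "F \<subseteq> edges (Gamma m)")
  case True
  interpret S: fin_multigraph "Gamma m\<lparr>edges := F\<rparr>"
    by (rule fin_multigraph_subgraph[OF True])
  let ?s = "\<lambda>i. pattern_size (pattern F i)"
  have tree_iff: "tree (Gamma m\<lparr>edges := F\<rparr>) \<longleftrightarrow>
      connected (Gamma m\<lparr>edges := F\<rparr>) \<and> 4 * m = Suc (\<Sum>i<m. ?s i)"
    using S.tree_iff_connected_card
    by (simp add: card_verts_Gamma card_eq_sum_pattern_size[OF True])
  have defect: "4 * m = Suc (\<Sum>i<m. ?s i) \<longleftrightarrow> (\<exists>j<m. \<forall>i<m. ?s i = (if i = j then 3 else 4))"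
    if adm: "\<And>i. i < m \<Longrightarrow> admissible (pattern F i)"
  proof -
    have le: "?s i \<le> 4" if "i < m" for i
      using admissible_size_le[OF adm[OF that]]
      by (auto simp: of_bool_def split: if_splits)
    \<comment> \<open>Since \<open>?s i\<close> is at most 4, the deficits \<open>4 - ?s i\<close>
      do not truncate. Their sum is 1 exactly if one copy has deficit 1 and all others 0.\<close>
    have "(\<Sum>i<m. 4 - ?s i) + (\<Sum>i<m. ?s i) = (\<Sum>i<m. 4)"
      unfolding sum.distrib[symmetric] using le by (intro sum.cong) auto
    then have "4 * m = Suc (\<Sum>i<m. ?s i) \<longleftrightarrow> (\<Sum>i<m. 4 - ?s i) = 1"
      by auto
    also have "\<dots> \<longleftrightarrow> (\<exists>j<m. 4 - ?s j = 1 \<and> (\<forall>i<m. j \<noteq> i \<longrightarrow> 4 - ?s i = 0))"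
      by (subst sum_eq_1_iff) auto
    also have "\<dots> \<longleftrightarrow> (\<exists>j<m. \<forall>i<m. ?s i = (if i = j then 3 else 4))"
    proof -
      have "4 - ?s i = 0 \<longleftrightarrow> ?s i = 4" if "i < m" for i
        using le[OF that] by auto
      moreover have "4 - ?s i = 1 \<longleftrightarrow> ?s i = 3" for i
        by auto
      ultimately show ?thesis
        by (intro ex_cong1 conj_cong refl) auto
    qed
    finally show ?thesis .
  qed
  have "tree (Gamma m\<lparr>edges := F\<rparr>) \<longleftrightarrow>
    (\<exists>j<m. \<forall>i<m. pattern F i \<in> patterns (if i = j then 3 else 4))"
  proof
    assume tree: "tree (Gamma m\<lparr>edges := F\<rparr>)"
    have adm: "admissible (pattern F i)" if "i < m" for i
      using tree_imp_admissible[OF True tree that] .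
    then show "\<exists>j<m. \<forall>i<m. pattern F i \<in> patterns (if i = j then 3 else 4)"
      using defect tree tree_iff by (simp add: patterns_def)
  next
    assume "\<exists>j<m. \<forall>i<m. pattern F i \<in> patterns (if i = j then 3 else 4)"
    then obtain j where j: "j < m" "\<And>i. i < m \<Longrightarrow> pattern F i \<in> patterns (if i = j then 3 else 4)"
      by blast
    then have "admissible (pattern F i)" "?s i = (if i = j then 3 else 4)" if "i < m" for i
      using j(2)[OF that] by (auto simp: patterns_def)
    then have "4 * m = Suc (\<Sum>i<m. ?s i)"
      using defect j(1) by blast
    then show "tree (Gamma m\<lparr>edges := F\<rparr>)"
      using tree_iff connected_if_patterns[OF True j] by blast
  qed
  then show ?thesis
    using True by (simp add: spanning_tree_def)
qed (simp add: spanning_tree_def)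

section \<open>Counting the families of patterns\<close>

lemma bij_betw_pattern:
  "bij_betw (\<lambda>F. restrict (pattern F) {..<m}) (Pow (edges (Gamma m))) ({..<m} \<rightarrow>\<^sub>E UNIV)"
proof (rule bij_betwI')
  fix F F' assume F: "F \<in> Pow (edges (Gamma m))" "F' \<in> Pow (edges (Gamma m))"
  show "restrict (pattern F) {..<m} = restrict (pattern F') {..<m} \<longleftrightarrow> F = F'"
  proof
    assume "restrict (pattern F) {..<m} = restrict (pattern F') {..<m}"
    then have "pattern F i = pattern F' i" if "i < m" for i
      using that by (metis lessThan_iff restrict_apply')
    then have "e \<in> F \<longleftrightarrow> e \<in> F'" if "e \<in> edges (Gamma m)" for e
      using that by (auto simp: Gamma_def pattern_def)
    then show "F = F'" using F by blast
  qed simp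
next
  fix f :: "nat \<Rightarrow> pattern" assume f: "f \<in> {..<m} \<rightarrow>\<^sub>E UNIV"
  \<comment> \<open>The inverse map reads membership of each edge off its position in the tuple, in
    the order fixed by \<open>pattern\<close>.\<close>
  let ?F = "{e \<in> edges (Gamma m). case e of TX i \<Rightarrow> fst (f i) | TY i \<Rightarrow> fst (snd (f i))
    | XY i \<Rightarrow> fst (snd (snd (f i))) | BX i \<Rightarrow> fst (snd (snd (snd (f i))))
    | BY i \<Rightarrow> fst (snd (snd (snd (snd (f i))))) | Link i \<Rightarrow> snd (snd (snd (snd (snd (f i)))))}"
  have "?F \<in> Pow (edges (Gamma m))"
    by blast
  moreover have "pattern ?F i = f i" if "i < m" for i
    using that by (simp add: pattern_def Gamma_def)
  then have "f = restrict (pattern ?F) {..<m}"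
    using f by (intro extensionalityI[of _ "{..<m}"]) (auto simp: PiE_def)
  ultimately show "\<exists>F\<in>Pow (edges (Gamma m)). f = restrict (pattern F) {..<m}" by blast
qed simp

theorem proposition4p4:
  fixes m :: nat
  assumes "m \<ge> 1"
  shows "complexity (Gamma m) = 2 * m * 8 ^ m"
proof -
  \<comment> \<open>\<open>?P j\<close> collects the families whose deficient copy is
    \<open>j\<close>.\<close>
  let ?P = "\<lambda>j. PiE {..<m} (\<lambda>i. patterns (if i = j then 3 else 4))"
  let ?r = "\<lambda>F. restrict (pattern F) {..<m}"
  have trees: "{F. spanning_tree (Gamma m) F} = {F \<in> Pow (edges (Gamma m)). ?r F \<in> (\<Union>j<m. ?P j)}"
  proof -
    have "?r F \<in> ?P j \<longleftrightarrow> (\<forall>i<m. pattern F i \<in> patterns (if i = j then 3 else 4))" for F j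
      by (auto simp: restrict_PiE_iff Pi_iff)
    then show ?thesis
      by (simp add: spanning_tree_Gamma_iff Bex_def)
  qed
  have "bij_betw ?r {F \<in> Pow (edges (Gamma m)). ?r F \<in> (\<Union>j<m. ?P j)} (\<Union>j<m. ?P j)"
  proof (rule bij_betw_subset[OF bij_betw_pattern])
    show "?r ` {F \<in> Pow (edges (Gamma m)). ?r F \<in> (\<Union>j<m. ?P j)} = (\<Union>j<m. ?P j)"
    proof
      show "(\<Union>j<m. ?P j) \<subseteq> ?r ` {F \<in> Pow (edges (Gamma m)). ?r F \<in> (\<Union>j<m. ?P j)}"
      proof
        fix f assume f: "f \<in> (\<Union>j<m. ?P j)"
        then have "f \<in> {..<m} \<rightarrow>\<^sub>E UNIV" by (auto simp: PiE_def)
        then obtain F where "F \<in> Pow (edges (Gamma m))" "f = ?r F"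
          using bij_betw_imp_surj_on[OF bij_betw_pattern[of m]] by blast
        then show "f \<in> ?r ` {F \<in> Pow (edges (Gamma m)). ?r F \<in> (\<Union>j<m. ?P j)}"
          using f by blast
      qed
    qed blast
  qed blast
  then have "complexity (Gamma m) = card (\<Union>j<m. ?P j)"
    unfolding complexity_def trees by (rule bij_betw_same_card)
  also have "\<dots> = (\<Sum>j<m. card (?P j))"
  proof (rule card_UN_disjoint)
    show "\<forall>j\<in>{..<m}. finite (?P j)"
      by (auto intro!: finite_PiE)
    \<comment> \<open>The deficient copy is determined by the family: a common member would have
      pattern size both 3 and 4 at \<open>j\<close>.\<close>
    show "\<forall>j\<in>{..<m}. \<forall>k\<in>{..<m}. j \<noteq> k \<longrightarrow> ?P j \<inter> ?P k = {}"
    proof (intro ballI impI equals0I)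
      fix j k f assume "j \<in> {..<m}" "j \<noteq> k" "f \<in> ?P j \<inter> ?P k"
      then have "f j \<in> patterns 3" "f j \<in> patterns 4"
        by (auto simp: PiE_iff dest!: bspec[of _ _ j])
      then show False by (simp add: patterns_def)
    qed
  qed simp
  also have "\<dots> = (\<Sum>j<m. 16 * 8 ^ (m - 1))"
  proof (rule sum.cong)
    fix j assume j: "j \<in> {..<m}"
    have "card (?P j) = (\<Prod>i<m. if i = j then 16 else 8)"
      by (auto simp: card_PiE card_patterns intro!: prod.cong)
    also have "\<dots> = 16 * (\<Prod>i\<in>{..<m} - {j}. 8)"
      using j by (subst prod.remove[of _ j]) (auto intro!: prod.cong)
    finally show "card (?P j) = 16 * 8 ^ (m - 1)"
      using j by simp
  qed simp
  \<comment> \<open>Writing 16 as \<open>2 * 8\<close> supplies the factor that completes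
    \<open>8 ^ m\<close>.\<close>
  also have "\<dots> = 2 * m * 8 ^ m"
    using assms by (cases m) auto
  finally show ?thesis .
qed

end
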